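(* Let $G$ be a finite $2$-group with $\exp(G)=4$, and suppose that $H=\{x\in G : x^2=e\}$ is a subgroup of $G$. Put $h=|H|$ and $r=[G:H]-1$. Then $D^*(G)\cong X_{h,r}$ (as graphs).
   Context: All graphs are finite, simple and undirected. A finite $2$-group is a finite group whose order is a power of $2$; $e$ is the identity, $o(x)$ the order of $x$, and $\exp(G)$ the least positive integer $m$ with $g^m=e$ for all $g\in G$. For a finite group $G$, the Proper POE Complement Graph $D^*(G)$ has vertex set $G^*=G\setminus\{e\}$, and two distinct vertices $x,y$ are adjacent if and only if $o(xy)$ is not a prime number. For an even integer $h\ge 2$ and an integer $r\ge 1$, the graph $X_{h,r}$ is the join $$X_{h,r}=\overline{K}_{h-1}\vee\left(\bigvee_{i=1}^{r}\left(\tfrac h2\right)K_2\right),$$ where $\overline{K}_{h-1}$ is the edgeless graph on $h-1$ vertices, $\left(\frac h2\right)K_2$ is the disjoint union of $\frac h2$ copies of $K_2$, and the join $\vee$ of pairwise vertex-disjoint graphs is obtained from their disjoint union by adding all edges between vertices of different constituents. *)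

theory Defs
  imports
    "HOL-Algebra.Multiplicative_Group"
    "HOL-Computational_Algebra.Primes"
    "Graph_Theory.Graph_Theory"
begin

text \<open>
  As in the Graph Theory library, a finite simple undirected graph is a finite, symmetric,
  loop-free digraph without parallel arcs (locale \<^locale>\<open>pair_graph\<close>), and two graphs are
  isomorphic if they are related by \<^const>\<open>digraph_iso\<close>.  The lemmas below show that every
  construction stays inside this class.
\<close>

subsection \<open>Constructions on graphs\<close>

definition edgeless_graph :: "nat \<Rightarrow> nat pair_pre_digraph" where
  "edgeless_graph n = \<lparr> pverts = {..<n}, parcs = {} \<rparr>"

definition complete_graph :: "nat \<Rightarrow> nat pair_pre_digraph" where
  "complete_graph n = \<lparr> pverts = {..<n}, parcs = {(u, v). u < n \<and> v < n \<and> u \<noteq> v} \<rparr>"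

text \<open>
  In families, vertices are tagged with the index of their constituent, which makes the
  constituents vertex-disjoint.
\<close>

definition disjoint_union :: "'i set \<Rightarrow> ('i \<Rightarrow> 'a pair_pre_digraph) \<Rightarrow> ('i \<times> 'a) pair_pre_digraph" where
  "disjoint_union I F =
     \<lparr> pverts = (SIGMA i:I. pverts (F i)),
       parcs = {((i, u), (j, v)) | i u j v. i \<in> I \<and> j = i \<and> (u, v) \<in> parcs (F i)} \<rparr>"

definition join_family :: "'i set \<Rightarrow> ('i \<Rightarrow> 'a pair_pre_digraph) \<Rightarrow> ('i \<times> 'a) pair_pre_digraph" where
  "join_family I F =
     \<lparr> pverts = pverts (disjoint_union I F),
       parcs = parcs (disjoint_union I F) \<union>
         {((i, u), (j, v)) | i u j v.
            i \<in> I \<and> j \<in> I \<and> i \<noteq> j \<and> u \<in> pverts (F i) \<and> v \<in> pverts (F j)} \<rparr>"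

definition graph_join :: "'a pair_pre_digraph \<Rightarrow> 'b pair_pre_digraph \<Rightarrow> ('a + 'b) pair_pre_digraph" where
  "graph_join A B =
     \<lparr> pverts = pverts A <+> pverts B,
       parcs = {(Inl u, Inl v) | u v. (u, v) \<in> parcs A} \<union>
               {(Inr u, Inr v) | u v. (u, v) \<in> parcs B} \<union>
               {(Inl u, Inr v) | u v. u \<in> pverts A \<and> v \<in> pverts B} \<union>
               {(Inr v, Inl u) | u v. u \<in> pverts A \<and> v \<in> pverts B} \<rparr>"

definition X_graph :: "nat \<Rightarrow> nat \<Rightarrow> (nat + nat \<times> nat \<times> nat) pair_pre_digraph" where
  "X_graph h r =
     graph_join (edgeless_graph (h - 1))
       (join_family {1..r} (\<lambda>i. disjoint_union {1..h div 2} (\<lambda>j. complete_graph 2)))"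

subsection \<open>Groups\<close>

definition finite_2_group :: "('a, 'b) monoid_scheme \<Rightarrow> bool" where
  "finite_2_group G \<longleftrightarrow> group G \<and> finite (carrier G) \<and> (\<exists>k. order G = 2 ^ k)"

definition group_exponent :: "('a, 'b) monoid_scheme \<Rightarrow> nat" where
  "group_exponent G = (LEAST m. 0 < m \<and> (\<forall>g\<in>carrier G. g [^]\<^bsub>G\<^esub> m = \<one>\<^bsub>G\<^esub>))"

definition proper_poe_complement_graph :: "('a, 'b) monoid_scheme \<Rightarrow> 'a pair_pre_digraph" where
  "proper_poe_complement_graph G =
     \<lparr> pverts = carrier G - {\<one>\<^bsub>G\<^esub>},
       parcs = {(x, y). x \<in> carrier G - {\<one>\<^bsub>G\<^esub>} \<and> y \<in> carrier G - {\<one>\<^bsub>G\<^esub>} \<and> x \<noteq> y \<and>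
                        \<not> Factorial_Ring.prime (group.ord G (x \<otimes>\<^bsub>G\<^esub> y))} \<rparr>"

subsection \<open>Well-formedness\<close>

lemma pair_graphI:
  assumes "finite (pverts A)"
    and "\<And>u v. (u, v) \<in> parcs A \<Longrightarrow> u \<in> pverts A \<and> v \<in> pverts A \<and> u \<noteq> v \<and> (v, u) \<in> parcs A"
  shows "pair_graph A"
proof -
  have "parcs A \<subseteq> pverts A \<times> pverts A" using assms(2) by auto
  then have "finite (parcs A)" using assms(1) by (meson finite_SigmaI finite_subset)
  then show ?thesis
    using assms by unfold_locales (force simp: symmetric_def sym_def)+
qed

lemma pair_graphD:
  assumes "pair_graph A"
  shows "finite (pverts A)"
    and "(u, v) \<in> parcs A \<Longrightarrow> u \<in> pverts A \<and> v \<in> pverts A \<and> u \<noteq> v \<and> (v, u) \<in> parcs A"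
proof -
  interpret pair_graph A by fact
  show "finite (pverts A)" by (rule pair_finite_verts)
  show "u \<in> pverts A \<and> v \<in> pverts A \<and> u \<noteq> v \<and> (v, u) \<in> parcs A" if "(u, v) \<in> parcs A"
    using that in_arcsD1 in_arcsD2 pair_no_loops[OF that] pair_sym_arcs
    by (auto simp: symmetric_def sym_def)
qed

lemma pair_graph_edgeless: "pair_graph (edgeless_graph n)"
  by (rule pair_graphI) (auto simp: edgeless_graph_def)

lemma pair_graph_complete: "pair_graph (complete_graph n)"
  by (rule pair_graphI) (auto simp: complete_graph_def)

lemma complete_graph_complete_digraph: "complete_digraph n (with_proj (complete_graph n))"
  unfolding complete_digraph_pair_def by (auto simp: complete_graph_def)

lemma pair_graph_disjoint_union:
  assumes "finite I" "\<And>i. i \<in> I \<Longrightarrow> pair_graph (F i)"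
  shows "pair_graph (disjoint_union I F)"
  by (rule pair_graphI) (auto simp: disjoint_union_def assms(1) dest: pair_graphD[OF assms(2)])

lemma pair_graph_join_family:
  assumes "finite I" "\<And>i. i \<in> I \<Longrightarrow> pair_graph (F i)"
  shows "pair_graph (join_family I F)"
  by (rule pair_graphI)
    (auto simp: join_family_def disjoint_union_def assms(1) dest: pair_graphD[OF assms(2)])

lemma pair_graph_graph_join:
  assumes "pair_graph A" "pair_graph B"
  shows "pair_graph (graph_join A B)"
  by (rule pair_graphI)
    (auto simp: graph_join_def pair_graphD(1)[OF assms(1)] pair_graphD(1)[OF assms(2)]
      dest: pair_graphD(2)[OF assms(1)] pair_graphD(2)[OF assms(2)])

lemma pair_graph_X_graph: "pair_graph (X_graph h r)"
  unfolding X_graph_def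
  by (intro pair_graph_graph_join pair_graph_edgeless pair_graph_join_family
      pair_graph_disjoint_union pair_graph_complete finite_atLeastAtMost)

lemma (in group) ord_mult_commute:
  assumes x: "x \<in> carrier G" and y: "y \<in> carrier G"
  shows "ord (x \<otimes> y) = ord (y \<otimes> x)"
proof -
  have pow: "(x \<otimes> y) [^] n \<otimes> x = x \<otimes> (y \<otimes> x) [^] n" for n :: nat
  proof (induction n)
    case (Suc n)
    have "(x \<otimes> y) [^] Suc n \<otimes> x = ((x \<otimes> y) [^] n \<otimes> x) \<otimes> (y \<otimes> x)"
      using x y by (simp add: m_assoc)
    also have "\<dots> = x \<otimes> (y \<otimes> x) [^] Suc n"
      unfolding Suc using x y by (simp add: m_assoc)
    finally show ?case .
  qed (use x in simp)
  have "(x \<otimes> y) [^] n = \<one> \<longleftrightarrow> (y \<otimes> x) [^] n = \<one>" for n :: nat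
    using pow[of n] x y l_cancel_one'[of x "(y \<otimes> x) [^] n"] r_cancel_one'[of x "(x \<otimes> y) [^] n"]
    by (metis l_one m_closed nat_pow_closed r_one)
  then show ?thesis unfolding ord_def by simp
qed

lemma pair_graph_proper_poe_complement_graph:
  assumes "group G" "finite (carrier G)"
  shows "pair_graph (proper_poe_complement_graph G)"
  by (rule pair_graphI)
    (auto simp: proper_poe_complement_graph_def assms(2) group.ord_mult_commute[OF assms(1)])

end

theory Submission
  imports Defs
begin

text \<open>
  Every order divides \<open>4\<close>, so \<open>o(xy)\<close> is prime iff \<open>xy\<close> is a non-identity element of \<open>H\<close>.
  Squares lie in \<open>H\<close>, hence \<open>Hx\<^sup>-\<^sup>1 = Hx\<close>, and \<open>xy \<in> H\<close> iff \<open>x\<close> and \<open>y\<close> lie in the same right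
  coset.  Thus distinct \<open>x\<close> and \<open>y\<close> are adjacent iff \<open>Hx \<noteq> Hy\<close> or \<open>y = x\<^sup>-\<^sup>1\<close>.  On \<open>H\<close> inversion is
  the identity, so \<open>H - {e}\<close> is edgeless; on every other coset it is a fixed-point-free involution,
  which splits the coset into \<open>h/2\<close> edges.
\<close>

section \<open>Graph isomorphisms and pairings by involutions\<close>

text \<open>An arc of a pair graph is just its pair of ends, so the vertex map forces the arc map
  \<open>map_prod f f\<close>. Since every arc of \<open>B\<close> has its ends in
  \<open>pverts B\<close>, surjectivity on vertices and \<open>arcs\<close> give surjectivity on
  arcs.\<close>

lemma digraph_iso_with_projI:
  assumes "pair_graph A"
    and bij: "bij_betw f (pverts A) (pverts B)"
    and B: "parcs B \<subseteq> pverts B \<times> pverts B"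
    and arcs: "\<And>u v. u \<in> pverts A \<Longrightarrow> v \<in> pverts A \<Longrightarrow> (f u, f v) \<in> parcs B \<longleftrightarrow> (u, v) \<in> parcs A"
  shows "digraph_iso (with_proj A) (with_proj B)"
proof -
  interpret A: pair_graph A by fact
  have sub: "parcs A \<subseteq> pverts A \<times> pverts A"
    using pair_graphD(2)[OF assms(1)] by auto
  have inj: "inj_on f (pverts A)" and img: "f ` pverts A = pverts B"
    using bij by (auto simp: bij_betw_def)
  let ?hom = "\<lparr>iso_verts = f, iso_arcs = map_prod f f, iso_head = snd, iso_tail = fst\<rparr>"
  have "inj_on (map_prod f f) (parcs A)"
    using map_prod_inj_on[OF inj inj] sub by (rule inj_on_subset)
  then have "pre_digraph.digraph_isomorphism (with_proj A) ?hom"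
    unfolding pre_digraph.digraph_isomorphism_def
    using A.wf_digraph_axioms inj by auto
  moreover have "map_prod f f ` parcs A = parcs B"
  proof (intro equalityI subsetI)
    fix e assume "e \<in> map_prod f f ` parcs A"
    then obtain u v where "(u, v) \<in> parcs A" "e = (f u, f v)" by auto
    moreover from this have "u \<in> pverts A" "v \<in> pverts A" using sub by auto
    ultimately show "e \<in> parcs B" using arcs by simp
  next
    fix e assume e: "e \<in> parcs B"
    then have "e \<in> f ` pverts A \<times> f ` pverts A" using B img by blast
    then obtain u v where uv: "u \<in> pverts A" "v \<in> pverts A" "e = (f u, f v)" by blast
    then have "(u, v) \<in> parcs A" using arcs e by simp
    then show "e \<in> map_prod f f ` parcs A" using uv(3) by (metis image_eqI map_prod_simp)
  qed
  then have "with_proj B = app_iso ?hom (with_proj A)"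
    by (simp add: app_iso_def with_proj_def img)
  ultimately show ?thesis
    unfolding digraph_iso_def by blast
qed

text \<open>The orbits of \<open>s\<close> are the pairs \<open>{x, s x}\<close>. The first
  coordinate of \<open>f\<close> numbers the orbit, the second tells its two elements apart; the
  induction removes one whole orbit, so that \<open>s\<close> still acts on the rest.\<close>

lemma fixpoint_free_involution_bij:
  fixes s :: "'a \<Rightarrow> 'a"
  assumes "finite A" "\<And>x. x \<in> A \<Longrightarrow> s x \<in> A \<and> s x \<noteq> x \<and> s (s x) = x"
  shows "\<exists>f. bij_betw f A ({1..card A div 2} \<times> {..<2::nat}) \<and>
    (\<forall>x\<in>A. \<forall>y\<in>A. y = s x \<longleftrightarrow> fst (f x) = fst (f y) \<and> snd (f x) \<noteq> snd (f y))"
  using assms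
proof (induction A rule: finite_psubset_induct)
  case (psubset A)
  note s = psubset.prems
  show ?case
  proof (cases "A = {}")
    case False
    then obtain a where a: "a \<in> A" by blast
    define A' where "A' = A - {a, s a}"
    have sub: "A' \<subset> A" using a by (auto simp: A'_def)
    have s': "s x \<in> A' \<and> s x \<noteq> x \<and> s (s x) = x" if "x \<in> A'" for x
    proof -
      have x: "x \<in> A" "x \<noteq> a" "x \<noteq> s a" using that by (auto simp: A'_def)
      moreover have "s x \<noteq> a" "s x \<noteq> s a"
        using s[OF x(1)] s[OF a] x(2,3) by metis+
      ultimately show ?thesis using s[OF x(1)] by (simp add: A'_def)
    qed
    obtain f where bij: "bij_betw f A' ({1..card A' div 2} \<times> {..<2::nat})"
      and f: "\<And>x y. x \<in> A' \<Longrightarrow> y \<in> A' \<Longrightarrow>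
        y = s x \<longleftrightarrow> fst (f x) = fst (f y) \<and> snd (f x) \<noteq> snd (f y)"
      using psubset.IH[OF sub s'] by blast
    have ne: "a \<noteq> s a" using s[OF a] by metis
    have A: "A = A' \<union> {a, s a}" and notin: "a \<notin> A'" "s a \<notin> A'"
      using a s[OF a] by (auto simp: A'_def)
    have "finite A'" using psubset.hyps by (simp add: A'_def)
    then have card: "card A div 2 = Suc (card A' div 2)"
      using ne notin by (simp add: A)
    define n where "n = card A' div 2"
    \<comment> \<open>The removed orbit receives the first number that \<open>f\<close> does not use
      on \<open>A'\<close>.\<close>
    define g where "g = f(a := (Suc n, 0), s a := (Suc n, 1))"
    have ga: "g a = (Suc n, 0)" "g (s a) = (Suc n, 1)" and gf: "\<And>x. x \<in> A' \<Longrightarrow> g x = f x"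
      using ne notin by (auto simp: g_def)
    have "bij_betw g A' ({1..n} \<times> {..<2})"
      using bij unfolding n_def by (simp only: bij_betw_cong[OF gf])
    moreover have "bij_betw g {a, s a} ({Suc n} \<times> {..<2})"
      using ne by (auto simp: bij_betw_def ga numeral_2_eq_2 lessThan_Suc)
    ultimately have "bij_betw g A ({1..n} \<times> {..<2} \<union> {Suc n} \<times> {..<2})"
      unfolding A by (rule bij_betw_combine) auto
    moreover have "{1..n} \<times> {..<2} \<union> {Suc n} \<times> {..<2} = {1..card A div 2} \<times> {..<2::nat}"
      by (auto simp: card n_def)
    moreover have "y = s x \<longleftrightarrow> fst (g x) = fst (g y) \<and> snd (g x) \<noteq> snd (g y)"
      if "x \<in> A" "y \<in> A" for x y
    proof -
      \<comment> \<open>This settles the mixed cases: orbit numbers differ, and \<open>s\<close>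
        maps neither \<open>A'\<close> nor \<open>{a, s a}\<close> into the other, so both sides are
        false.\<close>
      have small: "fst (g z) \<noteq> Suc n" if "z \<in> A'" for z
        using bij_betwE[OF bij] that gf[OF that] by (fastforce simp: n_def)
      consider "x \<in> A'" "y \<in> A'" | "x \<in> A'" "y \<in> {a, s a}" | "x \<in> {a, s a}" "y \<in> A'"
        | "x \<in> {a, s a}" "y \<in> {a, s a}"
        using \<open>x \<in> A\<close> \<open>y \<in> A\<close> A by blast
      then show ?thesis
      proof cases
        case 1
        then show ?thesis using f gf by simp
      next
        case 2
        then show ?thesis using small s' notin ga by (metis fst_conv insert_iff singletonD)
      next
        case 3
        then show ?thesis using small[of y] s[OF a] notin ga by auto
      next
        case 4
        then show ?thesis using s[OF a] ga by auto
      qed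
    qed
    ultimately show ?thesis by auto
  qed (simp add: bij_betw_def)
qed

section \<open>Coordinates for \<open>X_graph\<close>\<close>

text \<open>The nested tags flatten to triples: \<open>Inr (i, j, k)\<close> is end \<open>k\<close>
  of the \<open>j\<close>-th edge in the \<open>i\<close>-th constituent of the large join.\<close>

lemma pverts_X_graph:
  "pverts (X_graph h r) = {..<h - 1} <+> {1..r} \<times> {1..h div 2} \<times> {..<2}"
  by (simp add: X_graph_def graph_join_def edgeless_graph_def join_family_def disjoint_union_def
      complete_graph_def)

lemma parcs_X_graph:
  "(Inl a, Inl b) \<notin> parcs (X_graph h r)"
  "(Inl a, Inr p) \<in> parcs (X_graph h r) \<longleftrightarrow> a < h - 1 \<and> p \<in> {1..r} \<times> {1..h div 2} \<times> {..<2}"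
  "(Inr p, Inl a) \<in> parcs (X_graph h r) \<longleftrightarrow> a < h - 1 \<and> p \<in> {1..r} \<times> {1..h div 2} \<times> {..<2}"
  "(Inr p, Inr q) \<in> parcs (X_graph h r) \<longleftrightarrow>
     p \<in> {1..r} \<times> {1..h div 2} \<times> {..<2} \<and> q \<in> {1..r} \<times> {1..h div 2} \<times> {..<2} \<and>
     (fst p \<noteq> fst q \<or> fst (snd p) = fst (snd q) \<and> snd (snd p) \<noteq> snd (snd q))"
  by (cases p; cases q; auto simp: X_graph_def graph_join_def edgeless_graph_def join_family_def
      disjoint_union_def complete_graph_def)+

section \<open>Exponents and element orders\<close>

text \<open>The set under \<open>LEAST\<close> contains the group order, which is positive by
  finiteness, so the minimum is attained.\<close>

lemma (in group) pow_group_exponent: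
  assumes "finite (carrier G)" "x \<in> carrier G"
  shows "x [^] group_exponent G = \<one>"
proof -
  have "0 < order G \<and> (\<forall>g\<in>carrier G. g [^] order G = \<one>)"
    using assms(1) by (simp add: pow_order_eq_1 order_gt_0_iff_finite)
  then have "0 < group_exponent G \<and> (\<forall>g\<in>carrier G. g [^] group_exponent G = \<one>)"
    unfolding group_exponent_def by (rule LeastI)
  with assms(2) show ?thesis by blast
qed

text \<open>The order divides \<open>2 ^ 2\<close>, so \<open>2\<close> is the only prime it can
  equal.\<close>

lemma (in group) prime_ord_exponent_4:
  assumes "x \<in> carrier G" "x [^] (4::nat) = \<one>"
  shows "Factorial_Ring.prime (ord x) \<longleftrightarrow> x [^] (2::nat) = \<one> \<and> x \<noteq> \<one>"
proof -
  have "ord x dvd 2 ^ 2" using assms by (simp flip: pow_eq_id)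
  then have "Factorial_Ring.prime (ord x) \<longleftrightarrow> ord x = 2"
    by (metis prime_dvd_power primes_dvd_imp_eq two_is_prime_nat)
  also have "\<dots> \<longleftrightarrow> ord x dvd 2 \<and> ord x \<noteq> 1"
    using two_is_prime_nat by (auto simp: prime_nat_iff)
  finally show ?thesis
    using assms(1) by (simp only: pow_eq_id ord_eq_1 simp_thms)
qed

lemma (in group) card_coset_eq:
  assumes "subgroup H G" "R \<in> rcosets H"
  shows "card R = card H"
  using card_cosets_equal[OF assms(2) subgroup.subset[OF assms(1)]] bij_betw_same_card by metis

theorem theorem5p1:
  fixes G :: "('a, 'b) monoid_scheme" (structure)
    and H :: "'a set" and h r :: nat
  assumes "finite_2_group G"
    and "group_exponent G = 4"
    and "H = {x \<in> carrier G. x [^] (2::nat) = \<one>}"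
    and "subgroup H G"
    and "h = card H"
    and "r = card (rcosets H) - 1"
  shows "digraph_iso (with_proj (proper_poe_complement_graph G)) (with_proj (X_graph h r))"
proof -
  have grp: "group G" and fin: "finite (carrier G)"
    using assms(1) by (auto simp: finite_2_group_def)
  interpret group G by fact

  \<comment> \<open>Products and right cosets of \<open>H\<close>\<close>
  have pow2: "x [^] (2::nat) = x \<otimes> x" if "x \<in> carrier G" for x
    using that by (simp add: numeral_2_eq_2)
  have Hiff: "x \<in> H \<longleftrightarrow> x \<otimes> x = \<one>" if "x \<in> carrier G" for x
    using that pow2[OF that] by (simp add: assms(3))
  have pow4: "x [^] (4::nat) = \<one>" if "x \<in> carrier G" for x
    using pow_group_exponent[OF fin that] assms(2) by simp
  have sq: "x \<otimes> x \<in> H" if "x \<in> carrier G" for x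
    using nat_pow_pow[OF that, of 2 2] pow4[OF that] that by (simp add: assms(3) pow2[OF that])
  have prime_iff: "Factorial_Ring.prime (ord (x \<otimes> y)) \<longleftrightarrow> x \<otimes> y \<in> H \<and> y \<noteq> inv x"
    if "x \<in> carrier G" "y \<in> carrier G" for x y
  proof -
    have "x \<otimes> y = \<one> \<longleftrightarrow> y = inv x"
      using that by (metis inv_equality inv_inv r_inv inv_closed)
    then show ?thesis
      using prime_ord_exponent_4[OF _ pow4, of "x \<otimes> y"] that by (simp add: assms(3))
  qed
  interpret H: subgroup H G by fact
  note H.mem_carrier [simp del]
  have coset_self: "x \<in> H #> x" if "x \<in> carrier G" for x
    using that rcos_self assms(4) by blast
  have coset_eq_iff: "H #> x = H #> y \<longleftrightarrow> x \<in> H #> y" if "x \<in> carrier G" "y \<in> carrier G" for x y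
    using that coset_self repr_independence assms(4) by metis
  have coset_inv: "H #> inv x = H #> x" if "x \<in> carrier G" for x
  proof -
    \<comment> \<open>Membership amounts to \<open>x \<otimes> inv (inv x) = x \<otimes> x\<close>
      lying in \<open>H\<close>.\<close>
    have "x \<in> H #> inv x"
      using H.rcos_module_rev[OF grp, of "inv x" x] sq that by simp
    then show ?thesis using coset_eq_iff[of x "inv x"] that by simp
  qed
  \<comment> \<open>Read \<open>x \<otimes> y\<close> as \<open>x \<otimes> inv (inv y)\<close>: it
    lies in \<open>H\<close> iff \<open>x\<close> lies in \<open>H #> inv y\<close>, which is
    \<open>H #> y\<close>.\<close>
  have mult_in_H: "x \<otimes> y \<in> H \<longleftrightarrow> H #> x = H #> y" if "x \<in> carrier G" "y \<in> carrier G" for x y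
    using H.rcos_module[OF grp, of "inv y" x] coset_eq_iff[of x "inv y"] coset_inv that by simp
  have coset_H: "H #> x = H \<longleftrightarrow> x \<in> H" if "x \<in> carrier G" for x
    using that coset_join1 coset_join2 assms(4) by blast
  have inv_ne: "inv x \<noteq> x" if "x \<in> carrier G" "x \<notin> H" for x
    using that Hiff by (metis r_inv)

  \<comment> \<open>Numbering the cosets and their elements\<close>
  \<comment> \<open>Leaving out \<open>H\<close> itself accounts for the \<open>- 1\<close> in
    \<open>r\<close>; each remaining coset becomes one constituent of the large join.\<close>
  define \<C> where "\<C> = rcosets H - {H}"
  have finC: "finite (rcosets H)"
    using fin rcosets_subset_PowG[OF assms(4)] by (meson finite_Pow_iff finite_subset)
  have "card \<C> = r"
    using finC H.subgroup_in_rcosets[OF grp] by (simp add: \<C>_def assms(6))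
  then obtain c where c: "bij_betw c \<C> {1..r}"
    using finC finite_same_card_bij[of \<C> "{1..r}"] by (auto simp: \<C>_def)
  have finH: "finite H" using finite_subset[OF H.subset fin] .
  have "card (H - {\<one>}) = h - 1"
    using finH by (simp add: assms(5))
  then obtain g where g: "bij_betw g (H - {\<one>}) {..<h - 1}"
    using finH finite_same_card_bij[of "H - {\<one>}" "{..<h - 1}"] by auto
  have C_iff: "C \<in> \<C> \<longleftrightarrow> (\<exists>x \<in> carrier G - H. C = H #> x)" for C
  proof
    assume "C \<in> \<C>"
    then obtain x where "x \<in> carrier G" "C = H #> x" "C \<noteq> H"
      unfolding \<C>_def RCOSETS_def by blast
    then show "\<exists>x \<in> carrier G - H. C = H #> x" using coset_H by blast
  next
    assume "\<exists>x \<in> carrier G - H. C = H #> x"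
    then obtain x where x: "x \<in> carrier G" "x \<notin> H" "C = H #> x" by blast
    then have "C \<noteq> H" using coset_H by metis
    then show "C \<in> \<C>" using rcosetsI[OF H.subset x(1)] x(3) by (simp add: \<C>_def)
  qed
  have mem_C: "x \<in> carrier G - H \<and> H #> x = C" if C: "C \<in> \<C>" and x: "x \<in> C" for C x
  proof -
    obtain a where a: "a \<in> carrier G" "C = H #> a" using iffD1[OF C_iff C] by blast
    then have xG: "x \<in> carrier G" using x H.elemrcos_carrier[OF grp] by blast
    then have "H #> x = C" using coset_eq_iff[OF xG a(1)] a(2) x by blast
    moreover have "C \<noteq> H" using C by (simp add: \<C>_def)
    ultimately show ?thesis using coset_H[OF xG] xG by blast
  qed
  have "\<exists>f. bij_betw f C ({1..h div 2} \<times> {..<2::nat}) \<and>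
      (\<forall>x\<in>C. \<forall>y\<in>C. y = inv x \<longleftrightarrow> fst (f x) = fst (f y) \<and> snd (f x) \<noteq> snd (f y))"
    if C: "C \<in> \<C>" for C
  proof -
    have R: "C \<in> rcosets H" using C by (simp add: \<C>_def)
    have "finite C" using cosets_finite[OF R H.subset fin] .
    moreover have "inv x \<in> C \<and> inv x \<noteq> x \<and> inv (inv x) = x" if "x \<in> C" for x
    proof -
      have x: "x \<in> carrier G" "x \<notin> H" "H #> x = C" using mem_C[OF C \<open>x \<in> C\<close>] by auto
      then have "inv x \<in> C" using coset_inv coset_self inv_closed by metis
      then show ?thesis using inv_ne[OF x(1,2)] x(1) by simp
    qed
    \<comment> \<open>Equal coset sizes give every coset the same number \<open>h div 2\<close> of
      inverse pairs.\<close>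
    moreover have "card C = h" using card_coset_eq[OF assms(4) R] assms(5) by simp
    ultimately show ?thesis
      using fixpoint_free_involution_bij[of C "\<lambda>x. inv x"] by simp
  qed
  then have "\<forall>C\<in>\<C>. \<exists>f. bij_betw f C ({1..h div 2} \<times> {..<2::nat}) \<and>
      (\<forall>x\<in>C. \<forall>y\<in>C. y = inv x \<longleftrightarrow> fst (f x) = fst (f y) \<and> snd (f x) \<noteq> snd (f y))"
    by simp
  from bchoice[OF this] obtain p
    where p: "\<And>C. C \<in> \<C> \<Longrightarrow> bij_betw (p C) C ({1..h div 2} \<times> {..<2::nat})"
    and p_inv: "\<And>C x y. C \<in> \<C> \<Longrightarrow> x \<in> C \<Longrightarrow> y \<in> C \<Longrightarrow>
      y = inv x \<longleftrightarrow> fst (p C x) = fst (p C y) \<and> snd (p C x) \<noteq> snd (p C y)"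
    by blast

  \<comment> \<open>The vertex bijection\<close>
  \<comment> \<open>The three coordinates are the number of the coset, the number of the inverse
    pair within it, and the position in that pair.\<close>
  define q where "q x = (c (H #> x), p (H #> x) x)" for x
  define F where "F x = (if x \<in> H then Inl (g x) else Inr (q x))" for x
  have inC: "H #> x \<in> \<C>" if "x \<in> carrier G - H" for x
    by (rule iffD2[OF C_iff], rule bexI[OF refl that])
  have q_coset: "fst (q x) = fst (q y) \<longleftrightarrow> H #> x = H #> y"
    if x: "x \<in> carrier G - H" and y: "y \<in> carrier G - H" for x y
    using inj_on_eq_iff[OF bij_betw_imp_inj_on[OF c] inC[OF x] inC[OF y]] by (simp add: q_def)
  have q_range: "q x \<in> {1..r} \<times> {1..h div 2} \<times> {..<2}" if x: "x \<in> carrier G - H" for x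
  proof -
    have "c (H #> x) \<in> {1..r}" using bij_betwE[OF c] inC[OF x] by blast
    moreover have "p (H #> x) x \<in> {1..h div 2} \<times> {..<2}"
      using bij_betwE[OF p[OF inC[OF x]]] coset_self x by blast
    ultimately show ?thesis unfolding q_def by blast
  qed
  have q: "bij_betw q (carrier G - H) ({1..r} \<times> {1..h div 2} \<times> {..<2})"
  proof (rule bij_betw_imageI)
    show "inj_on q (carrier G - H)"
    proof (rule inj_onI)
      fix x y assume x: "x \<in> carrier G - H" and y: "y \<in> carrier G - H" and eq: "q x = q y"
      \<comment> \<open>Equal first coordinates mean a common coset, so the other coordinates come
        from a single injective map \<open>p (H #> x)\<close>.\<close>
      then have xy: "H #> x = H #> y" using q_coset[OF x y] by simp
      then have "p (H #> x) x = p (H #> x) y" using eq by (simp add: q_def)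
      moreover have "x \<in> H #> x" "y \<in> H #> x" using coset_self x y xy by auto
      ultimately show "x = y"
        using inj_onD[OF bij_betw_imp_inj_on[OF p[OF inC[OF x]]]] by blast
    qed
    show "q ` (carrier G - H) = {1..r} \<times> {1..h div 2} \<times> {..<2}"
    proof (intro equalityI subsetI)
      fix z assume "z \<in> {1..r} \<times> {1..h div 2} \<times> {..<2::nat}"
      then obtain i w where z: "z = (i, w)" "i \<in> {1..r}" "w \<in> {1..h div 2} \<times> {..<2}" by blast
      have "i \<in> c ` \<C>" using z(2) bij_betw_imp_surj_on[OF c] by simp
      then obtain C where C: "C \<in> \<C>" "c C = i" by blast
      have "w \<in> p C ` C" using z(3) bij_betw_imp_surj_on[OF p[OF C(1)]] by simp
      then obtain x where x: "x \<in> C" "p C x = w" by blast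
      then have "q x = z" using mem_C[OF C(1) x(1)] C(2) z(1) by (simp add: q_def)
      then show "z \<in> q ` (carrier G - H)"
        using mem_C[OF C(1) x(1)] by blast
    qed (use q_range in blast)
  qed
  have "bij_betw F (H - {\<one>}) (Inl ` {..<h - 1})"
    using bij_betw_trans[OF g, of Inl "Inl ` {..<h - 1}"]
    by (auto simp: F_def bij_betw_def inj_on_def)
  moreover have "bij_betw F (carrier G - H) (Inr ` ({1..r} \<times> {1..h div 2} \<times> {..<2}))"
    using q by (auto simp: F_def bij_betw_def inj_on_def image_iff)
  ultimately have "bij_betw F ((H - {\<one>}) \<union> (carrier G - H)) (pverts (X_graph h r))"
    unfolding pverts_X_graph Plus_def by (rule bij_betw_combine) auto
  moreover have "(H - {\<one>}) \<union> (carrier G - H) = carrier G - {\<one>}"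
    using H.one_closed H.subset by auto
  ultimately have F: "bij_betw F (carrier G - {\<one>}) (pverts (X_graph h r))" by simp

  \<comment> \<open>Comparison of adjacency\<close>
  have adj: "(F x, F y) \<in> parcs (X_graph h r) \<longleftrightarrow>
      x \<noteq> y \<and> (H #> x \<noteq> H #> y \<or> y = inv x)"
    if x: "x \<in> carrier G - {\<one>}" and y: "y \<in> carrier G - {\<one>}" for x y
  proof -
    have gr: "g z < h - 1" if "z \<in> H" "z \<noteq> \<one>" for z using bij_betwE[OF g] that by auto
    note qr = q_range[OF DiffI]
    consider "x \<in> H" "y \<in> H" | "x \<in> H" "y \<notin> H" | "x \<notin> H" "y \<in> H" | "x \<notin> H" "y \<notin> H" by blast
    then show ?thesis
    proof cases
      case 1
      \<comment> \<open>Both elements lie in the coset \<open>H\<close>, and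
        \<open>y = inv x\<close> would force \<open>y = x\<close>; so the right-hand side fails, as
        does adjacency between two \<open>Inl\<close> vertices.\<close>
      have "inv x = x" using 1 x Hiff inv_equality by (metis DiffD1)
      then show ?thesis using 1 x y coset_H by (auto simp: F_def parcs_X_graph)
    next
      case 2
      then have "H #> x \<noteq> H #> y" using coset_H x y by auto
      then show ?thesis using 2 x y gr qr by (auto simp: F_def parcs_X_graph)
    next
      case 3
      then have "H #> x \<noteq> H #> y" using coset_H x y by auto
      then show ?thesis using 3 x y gr qr by (auto simp: F_def parcs_X_graph)
    next
      case 4
      \<comment> \<open>Different first coordinates give an arc of the large join; otherwise an arc
        must be one of the copies of the two-vertex complete graph, whose ends are an inverse
        pair.\<close>
      then have *: "(F x, F y) \<in> parcs (X_graph h r) \<longleftrightarrow>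
          fst (q x) \<noteq> fst (q y) \<or>
          fst (snd (q x)) = fst (snd (q y)) \<and> snd (snd (q x)) \<noteq> snd (snd (q y))"
        using x y qr by (simp add: F_def parcs_X_graph(4))
      have qc: "fst (q x) = fst (q y) \<longleftrightarrow> H #> x = H #> y"
        using q_coset x y 4 by simp
      \<comment> \<open>Hence \<open>y = inv x\<close> already entails \<open>x \<noteq> y\<close>,
        as do different cosets.\<close>
      have ne: "inv x \<noteq> x" using inv_ne x 4 by simp
      show ?thesis
      proof (cases "H #> x = H #> y")
        case True
        have "fst (snd (q x)) = fst (snd (q y)) \<and> snd (snd (q x)) \<noteq> snd (snd (q y)) \<longleftrightarrow> y = inv x"
          using p_inv[OF inC, of x x y] coset_self[of x] coset_self[of y] x y 4 True
          by (simp add: q_def)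
        then show ?thesis unfolding * qc using True ne by blast
      next
        case False
        then show ?thesis unfolding * qc by blast
      qed
    qed
  qed

  \<comment> \<open>Assembling the isomorphism\<close>
  show ?thesis
  proof (rule digraph_iso_with_projI)
    show "pair_graph (proper_poe_complement_graph G)"
      by (rule pair_graph_proper_poe_complement_graph[OF grp fin])
    show "bij_betw F (pverts (proper_poe_complement_graph G)) (pverts (X_graph h r))"
      using F by (simp add: proper_poe_complement_graph_def)
    show "parcs (X_graph h r) \<subseteq> pverts (X_graph h r) \<times> pverts (X_graph h r)"
      using pair_graphD(2)[OF pair_graph_X_graph] by auto
    show "(F x, F y) \<in> parcs (X_graph h r) \<longleftrightarrow> (x, y) \<in> parcs (proper_poe_complement_graph G)"
      if "x \<in> pverts (proper_poe_complement_graph G)" "y \<in> pverts (proper_poe_complement_graph G)"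
      for x y
    proof -
      have xy: "x \<in> carrier G - {\<one>}" "y \<in> carrier G - {\<one>}"
        using that by (simp_all add: proper_poe_complement_graph_def)
      then have "\<not> Factorial_Ring.prime (ord (x \<otimes> y)) \<longleftrightarrow> H #> x \<noteq> H #> y \<or> y = inv x"
        using prime_iff[of x y] mult_in_H[of x y] by blast
      then show ?thesis
        unfolding adj[OF xy] using xy by (simp add: proper_poe_complement_graph_def)
    qed
  qed
qed

end
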